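(* Let $n$ be a positive integer, and let $X=(\mathbb{R}^n,\|\cdot\|_X)$ and $Y=(\mathbb{R}^n,\|\cdot\|_Y)$ be two Banach spaces satisfying $d_{BM}^M(X,Y)\leq \gamma$ for some real number $\gamma\geq 1$. Then $$\beta(X,m)\leq \gamma\,\beta(Y,m)\quad\text{for every positive integer } m.$$
   Context: All spaces are real. For $X=(\mathbb{R}^n,\|\cdot\|)$ and a nonempty bounded set $A\subset\mathbb{R}^n$, $\delta_X(A)=\sup\{\|x-y\| : x,y\in A\}$ is the diameter of $A$ in $X$. Let $\mathcal{B}^n$ be the family of all bounded subsets of $\mathbb{R}^n$ with positive diameter (this does not depend on the norm). For a positive integer $m$ and $A\in\mathcal{B}^n$, $$\beta_X(A,m)=\inf\left\{\frac{1}{\delta_X(A)}\max_{1\leq k\leq m}\delta_X(A_k) : A=\bigcup_{k=1}^m A_k\right\},$$ where the empty set, if it occurs among the $A_k$, is given diameter $0$. Put $\beta(X,m)=\sup\{\beta_X(A,m) : A\in\mathcal{B}^n\}$. The (multiplicative) Banach-Mazur distance is $d_{BM}^M(X,Y)=\inf\{\|T\|\cdot\|T^{-1}\| : T \text{ is a linear isomorphism from } X \text{ onto } Y\}$. *)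

theory Defs
  imports "HOL-Analysis.Analysis"
begin

text \<open>
  The type class \<open>real_normed_vector\<close> fixes one norm per type, whereas here
  different norms on the same space are compared.  A normed space
  \<open>X = (\<real>\<^sup>n, \<parallel>\<cdot>\<parallel>)\<close> is therefore given by a function \<open>N :: real ^ 'n \<Rightarrow> real\<close> with
  \<open>is_norm N\<close>.  Completeness is automatic in finite dimension.
\<close>

definition is_norm :: "('a::real_vector \<Rightarrow> real) \<Rightarrow> bool" where
  "is_norm N \<longleftrightarrow>
     (\<forall>x. 0 \<le> N x) \<and>
     (\<forall>x. N x = 0 \<longleftrightarrow> x = 0) \<and>
     (\<forall>a x. N (a *\<^sub>R x) = \<bar>a\<bar> * N x) \<and>
     (\<forall>x y. N (x + y) \<le> N x + N y)"

text \<open>The empty set has diameter \<open>0\<close>, as for the library constant \<open>diameter\<close>.\<close>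

definition diam :: "('a::real_vector \<Rightarrow> real) \<Rightarrow> 'a set \<Rightarrow> real" where
  "diam N A = (if A = {} then 0 else Sup {N (x - y) | x y. x \<in> A \<and> y \<in> A})"

text \<open>
  All norms on \<open>\<real>\<^sup>n\<close> are equivalent, so boundedness and positivity of the diameter
  do not depend on the norm; here they refer to the Euclidean one.
\<close>

definition bounded_sets_pos_diam :: "(real ^ 'n) set set" where
  "bounded_sets_pos_diam = {A. bounded A \<and> 0 < diameter A}"

text \<open>
  For \<open>m \<ge> 1\<close>, \<open>is_norm N\<close> and \<open>A\<close> in the family above, the trivial cover
  \<open>A\<^sub>k = A\<close> gives the value \<open>1\<close> and all values are nonnegative.  Hence the real-valued
  \<open>Inf\<close> and \<open>Sup\<close> below are taken over nonempty sets that are bounded on the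
  relevant side.
\<close>

definition beta_set :: "(real ^ 'n \<Rightarrow> real) \<Rightarrow> (real ^ 'n) set \<Rightarrow> nat \<Rightarrow> real" where
  "beta_set N A m =
     Inf {1 / diam N A * Max ((\<lambda>k. diam N (C k)) ` {1..m}) | C :: nat \<Rightarrow> (real ^ 'n) set.
            A = (\<Union>k\<in>{1..m}. C k)}"

definition beta :: "(real ^ 'n \<Rightarrow> real) \<Rightarrow> nat \<Rightarrow> real" where
  "beta N m = Sup {beta_set N A m | A. A \<in> bounded_sets_pos_diam}"

definition op_norm ::
    "('a::real_vector \<Rightarrow> real) \<Rightarrow> ('b::real_vector \<Rightarrow> real) \<Rightarrow> ('a \<Rightarrow> 'b) \<Rightarrow> real" where
  "op_norm NX NY T = Sup {NY (T x) | x. NX x \<le> 1}"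

definition banach_mazur_dist :: "(real ^ 'n \<Rightarrow> real) \<Rightarrow> (real ^ 'n \<Rightarrow> real) \<Rightarrow> real" where
  "banach_mazur_dist NX NY =
     Inf {op_norm NX NY T * op_norm NY NX (inv T) | T :: real ^ 'n \<Rightarrow> real ^ 'n.
            linear T \<and> bij T}"

end

theory Submission
  imports Defs
begin

text \<open>
  A linear isomorphism \<open>T\<close> carries covers of \<open>A\<close> to covers of \<open>T ` A\<close> and back.  Pulling a cover of
  \<open>T ` A\<close> back to \<open>A\<close> enlarges the diameters of its pieces by at most the factor \<open>\<parallel>T\<^sup>-\<^sup>1\<parallel>\<close>, while
  passing from \<open>T ` A\<close> to \<open>A\<close> shrinks the normalising diameter of the whole set by at most the
  factor \<open>\<parallel>T\<parallel>\<close>.  Hence every ratio for \<open>T ` A\<close> in \<open>Y\<close> yields a ratio for \<open>A\<close> in \<open>X\<close> that is at most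
  \<open>\<parallel>T\<parallel> \<cdot> \<parallel>T\<^sup>-\<^sup>1\<parallel>\<close> times as large (\<open>beta_set_le_linear_iso\<close>), and taking the supremum over \<open>A\<close> gives
  \<open>\<beta>(X, m) \<le> \<parallel>T\<parallel> \<cdot> \<parallel>T\<^sup>-\<^sup>1\<parallel> \<cdot> \<beta>(Y, m)\<close>.  The distance is an infimum over \<open>T\<close> of these products, so
  a final limit replaces the product by \<open>\<gamma>\<close>.

  The analytic input is that every norm on a Euclidean space is equivalent to the Euclidean one.
  It makes all suprema involved finite: those defining diameters of bounded sets, and those
  defining operator norms.
\<close>

section \<open>Equivalence with the Euclidean norm\<close>

lemma is_norm_nonneg: "is_norm N \<Longrightarrow> 0 \<le> N x"
  and is_norm_eq_0_iff: "is_norm N \<Longrightarrow> N x = 0 \<longleftrightarrow> x = 0"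
  and is_norm_scaleR: "is_norm N \<Longrightarrow> N (a *\<^sub>R x) = \<bar>a\<bar> * N x"
  and is_norm_triangle: "is_norm N \<Longrightarrow> N (x + y) \<le> N x + N y"
  by (auto simp: is_norm_def)

lemma is_norm_zero: "is_norm N \<Longrightarrow> N 0 = 0"
  by (simp add: is_norm_eq_0_iff)

lemma is_norm_pos: "is_norm N \<Longrightarrow> x \<noteq> 0 \<Longrightarrow> 0 < N x"
  by (metis is_norm_nonneg is_norm_eq_0_iff less_eq_real_def)

lemma is_norm_minus_commute:
  assumes "is_norm N"
  shows "N (x - y) = N (y - x)"
  using is_norm_scaleR[OF assms, of "-1" "x - y"] by simp

lemma is_norm_sum_le:
  assumes "is_norm N"
  shows "N (\<Sum>i\<in>I. f i) \<le> (\<Sum>i\<in>I. N (f i))"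
proof (induction I rule: infinite_finite_induct)
  case (insert i I)
  then show ?case
    using is_norm_triangle[OF assms, of "f i" "sum f I"] by simp
qed (simp_all add: is_norm_zero[OF assms])

lemma is_norm_le_norm:
  fixes N :: "'a::euclidean_space \<Rightarrow> real"
  assumes "is_norm N"
  obtains c where "0 < c" "\<And>x. N x \<le> c * norm x"
proof
  let ?s = "\<Sum>b\<in>Basis. N b"
  show "0 < 1 + ?s"
    by (simp add: add_pos_nonneg sum_nonneg is_norm_nonneg[OF assms])
  fix x :: 'a
  have "N x = N (\<Sum>b\<in>Basis. (x \<bullet> b) *\<^sub>R b)"
    by (simp add: euclidean_representation)
  also have "\<dots> \<le> (\<Sum>b\<in>Basis. N ((x \<bullet> b) *\<^sub>R b))"
    by (rule is_norm_sum_le[OF assms])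
  also have "\<dots> \<le> (\<Sum>b\<in>Basis. norm x * N b)"
    by (intro sum_mono)
      (simp add: is_norm_scaleR[OF assms] is_norm_nonneg[OF assms] mult_right_mono Basis_le_norm)
  also have "\<dots> = norm x * ?s"
    by (simp add: sum_distrib_left)
  also have "\<dots> \<le> (1 + ?s) * norm x"
    by (simp add: algebra_simps)
  finally show "N x \<le> (1 + ?s) * norm x" .
qed

lemma is_norm_continuous_on:
  fixes N :: "'a::euclidean_space \<Rightarrow> real"
  assumes N: "is_norm N"
  shows "continuous_on S N"
proof -
  obtain c where c: "0 < c" "\<And>x. N x \<le> c * norm x"
    using is_norm_le_norm[OF N] by blast
  have "\<bar>N x - N y\<bar> \<le> c * norm (x - y)" for x y
    using is_norm_triangle[OF N, of "x - y" y] is_norm_triangle[OF N, of "y - x" x]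
      is_norm_minus_commute[OF N, of x y] c(2)[of "x - y"] by simp
  then have "c-lipschitz_on S N"
    using c(1) by (intro lipschitz_onI) (auto simp: dist_norm)
  then show ?thesis
    by (rule lipschitz_on_continuous_on)
qed

text \<open>
  By compactness of the Euclidean unit sphere, \<open>N\<close> attains a minimum there; it is positive because
  \<open>N\<close> vanishes only at the origin, and its reciprocal is the constant sought.
\<close>

lemma norm_le_is_norm:
  fixes N :: "'a::euclidean_space \<Rightarrow> real"
  assumes N: "is_norm N"
  obtains c where "0 < c" "\<And>x. norm x \<le> c * N x"
proof -
  have "sphere (0::'a) 1 \<noteq> {}"
    using SOME_Basis norm_Basis by (auto intro!: exI[of _ "SOME b::'a. b \<in> Basis"])
  then obtain u where u: "norm u = 1" and min: "\<And>x. norm x = 1 \<Longrightarrow> N u \<le> N x"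
    using continuous_attains_inf[OF compact_sphere _ is_norm_continuous_on[OF N], of "0::'a" 1]
    by auto
  have pos: "0 < N u"
    using u by (intro is_norm_pos[OF N]) auto
  have "norm x \<le> (1 / N u) * N x" for x
  proof (cases "x = 0")
    case True
    then show ?thesis by (simp add: is_norm_zero[OF N])
  next
    case False
    then have "N u \<le> N ((1 / norm x) *\<^sub>R x)"
      by (intro min) simp
    also have "\<dots> = N x / norm x"
      by (simp add: is_norm_scaleR[OF N])
    finally show ?thesis
      using False pos by (simp add: field_simps)
  qed
  then show ?thesis
    using that[of "1 / N u"] pos by simp
qed

section \<open>Operator norms\<close>

lemma is_norm_op_norm_bound:
  fixes NX :: "'a::euclidean_space \<Rightarrow> real" and NY :: "'b::euclidean_space \<Rightarrow> real"
  assumes NX: "is_norm NX" and NY: "is_norm NY" and T: "linear T"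
  shows "NY (T x) \<le> op_norm NX NY T * NX x"
proof (cases "x = 0")
  case True
  then show ?thesis
    using T by (simp add: linear_0 is_norm_zero[OF NX] is_norm_zero[OF NY])
next
  case False
  obtain c where c: "0 < c" "\<And>x. norm x \<le> c * NX x"
    using norm_le_is_norm[OF NX] by blast
  obtain d where d: "0 < d" "\<And>y. NY y \<le> d * norm y"
    using is_norm_le_norm[OF NY] by blast
  obtain K where K: "0 < K" "\<And>x. norm (T x) \<le> K * norm x"
    using linear_bounded_pos[OF T] by blast
  have "NY (T z) \<le> d * (K * c)" if "NX z \<le> 1" for z
  proof -
    have "norm z \<le> c * 1"
      using c(2)[of z] mult_left_mono[OF that, of c] c(1) by linarith
    then have "norm (T z) \<le> K * c"
      using K(2)[of z] mult_left_mono[of "norm z" c K] K(1) by linarith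
    then show ?thesis
      using d(2)[of "T z"] mult_left_mono[of "norm (T z)" "K * c" d] d(1) by linarith
  qed
  then have bdd: "bdd_above {NY (T z) | z. NX z \<le> 1}"
    by (auto intro!: bdd_aboveI[where M = "d * (K * c)"])
  have pos: "0 < NX x"
    using False by (rule is_norm_pos[OF NX])
  have "NX ((1 / NX x) *\<^sub>R x) \<le> 1"
    using pos by (simp add: is_norm_scaleR[OF NX])
  then have "NY (T ((1 / NX x) *\<^sub>R x)) \<le> op_norm NX NY T"
    unfolding op_norm_def by (intro cSup_upper bdd) auto
  moreover have "NY (T ((1 / NX x) *\<^sub>R x)) = NY (T x) / NX x"
    using pos by (simp add: linear_scale[OF T] is_norm_scaleR[OF NY])
  ultimately show ?thesis
    using pos by (simp add: field_simps)
qed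

lemma op_norm_nonneg:
  fixes NX :: "'a::euclidean_space \<Rightarrow> real" and NY :: "'b::euclidean_space \<Rightarrow> real"
  assumes NX: "is_norm NX" and NY: "is_norm NY" and T: "linear T"
  shows "0 \<le> op_norm NX NY T"
proof -
  obtain b :: 'a where "b \<in> Basis"
    using SOME_Basis by blast
  then have "0 < NX b"
    by (intro is_norm_pos[OF NX]) auto
  moreover have "0 \<le> op_norm NX NY T * NX b"
    using is_norm_op_norm_bound[OF NX NY T, of b] is_norm_nonneg[OF NY, of "T b"] by linarith
  ultimately show ?thesis
    by (simp add: zero_le_mult_iff)
qed

lemma op_norm_pos:
  fixes NX :: "'a::euclidean_space \<Rightarrow> real" and NY :: "'b::euclidean_space \<Rightarrow> real"
  assumes NX: "is_norm NX" and NY: "is_norm NY" and T: "linear T" and x: "T x \<noteq> 0"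
  shows "0 < op_norm NX NY T"
proof -
  have "0 < op_norm NX NY T * NX x"
    using is_norm_op_norm_bound[OF NX NY T, of x] is_norm_pos[OF NY x] by linarith
  then show ?thesis
    using is_norm_nonneg[OF NX, of x] by (simp add: zero_less_mult_iff)
qed

section \<open>Diameters\<close>

lemma mem_bounded_sets_pos_diam_iff:
  "A \<in> bounded_sets_pos_diam \<longleftrightarrow> bounded A \<and> (\<exists>x\<in>A. \<exists>y\<in>A. x \<noteq> y)"
proof -
  have "\<exists>x\<in>A. \<exists>y\<in>A. x \<noteq> y" if "0 < diameter A"
  proof (rule ccontr)
    assume "\<not> ?thesis"
    then have "norm (x - y) \<le> 0" if "x \<in> A" "y \<in> A" for x y
      using that by auto
    then have "diameter A \<le> 0"
      by (intro diameter_le) auto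
    then show False
      using that by simp
  qed
  moreover have "0 < diameter A" if "bounded A" "x \<in> A" "y \<in> A" "x \<noteq> y" for x y
    using diameter_bounded_bound[OF that(1-3)] that(4) zero_less_dist_iff[of x y] by linarith
  ultimately show ?thesis
    by (auto simp: bounded_sets_pos_diam_def)
qed

lemma diam_upper:
  fixes N :: "'a::euclidean_space \<Rightarrow> real"
  assumes N: "is_norm N" and A: "bounded A" "x \<in> A" "y \<in> A"
  shows "N (x - y) \<le> diam N A"
proof -
  obtain c where c: "0 < c" "\<And>x. N x \<le> c * norm x"
    using is_norm_le_norm[OF N] by blast
  have "N (u - v) \<le> c * diameter A" if "u \<in> A" "v \<in> A" for u v
    using c(2)[of "u - v"] diameter_bounded_bound[OF A(1) that] c(1)
      mult_left_mono[of "dist u v" "diameter A" c] unfolding dist_norm by linarith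
  then have "bdd_above {N (u - v) | u v. u \<in> A \<and> v \<in> A}"
    by (auto intro!: bdd_aboveI[where M = "c * diameter A"])
  then show ?thesis
    using A by (auto simp: diam_def intro!: cSup_upper)
qed

lemma diam_least:
  assumes "\<And>x y. x \<in> A \<Longrightarrow> y \<in> A \<Longrightarrow> N (x - y) \<le> d" "0 \<le> d"
  shows "diam N A \<le> d"
proof (cases "A = {}")
  case False
  then have "Sup {N (x - y) | x y. x \<in> A \<and> y \<in> A} \<le> d"
    using assms(1) by (intro cSup_least) blast+
  then show ?thesis
    using False by (simp add: diam_def)
qed (simp add: diam_def assms(2))

lemma diam_nonneg:
  fixes N :: "'a::euclidean_space \<Rightarrow> real"
  assumes N: "is_norm N" and A: "bounded A"
  shows "0 \<le> diam N A"
proof (cases "A = {}")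
  case False
  then obtain x where "x \<in> A" by blast
  then show ?thesis
    using diam_upper[OF N A, of x x] by (simp add: is_norm_zero[OF N])
qed (simp add: diam_def)

lemma diam_pos:
  assumes N: "is_norm N" and A: "A \<in> bounded_sets_pos_diam"
  shows "0 < diam N A"
proof -
  obtain x y where "bounded A" "x \<in> A" "y \<in> A" "x \<noteq> y"
    using A by (auto simp: mem_bounded_sets_pos_diam_iff)
  then show ?thesis
    using diam_upper[OF N, of A x y] is_norm_pos[OF N, of "x - y"] by simp
qed

lemma diam_linear_image_le:
  fixes NX :: "'a::euclidean_space \<Rightarrow> real" and NY :: "'b::euclidean_space \<Rightarrow> real"
  assumes NX: "is_norm NX" and NY: "is_norm NY" and T: "linear T" and A: "bounded A"
  shows "diam NY (T ` A) \<le> op_norm NX NY T * diam NX A"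
proof (rule diam_least)
  have op: "0 \<le> op_norm NX NY T"
    by (rule op_norm_nonneg[OF NX NY T])
  show "0 \<le> op_norm NX NY T * diam NX A"
    using op diam_nonneg[OF NX A] by simp
  fix u v assume "u \<in> T ` A" "v \<in> T ` A"
  then obtain x y where xy: "x \<in> A" "y \<in> A" "u = T x" "v = T y"
    by blast
  have "NY (u - v) \<le> op_norm NX NY T * NX (x - y)"
    using is_norm_op_norm_bound[OF NX NY T, of "x - y"] xy by (simp add: linear_diff[OF T])
  also have "\<dots> \<le> op_norm NX NY T * diam NX A"
    by (intro mult_left_mono diam_upper[OF NX A] xy op)
  finally show "NY (u - v) \<le> op_norm NX NY T * diam NX A" .
qed

section \<open>Covering ratios\<close>

definition cover_ratio ::
    "('a::real_vector \<Rightarrow> real) \<Rightarrow> 'a set \<Rightarrow> nat \<Rightarrow> (nat \<Rightarrow> 'a set) \<Rightarrow> real" where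
  "cover_ratio N A m C = 1 / diam N A * Max ((\<lambda>k. diam N (C k)) ` {1..m})"

lemma beta_set_eq_Inf_cover_ratio:
  "beta_set N A m = Inf {cover_ratio N A m C | C. A = (\<Union>k\<in>{1..m}. C k)}"
  by (simp add: beta_set_def cover_ratio_def)

lemma bounded_cover_piece:
  assumes "bounded A" "A = (\<Union>k\<in>{1..m}. C k)" "k \<in> {1..m}"
  shows "bounded (C k)"
  using assms by (blast intro: bounded_subset)

lemma cover_ratio_nonneg:
  fixes N :: "'a::euclidean_space \<Rightarrow> real"
  assumes N: "is_norm N" and A: "bounded A" and m: "1 \<le> m" and C: "A = (\<Union>k\<in>{1..m}. C k)"
  shows "0 \<le> cover_ratio N A m C"
proof -
  have "bounded (C 1)"
    using bounded_cover_piece[OF A C, of 1] m by simp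
  then have "0 \<le> diam N (C 1)"
    by (rule diam_nonneg[OF N])
  also have "\<dots> \<le> Max ((\<lambda>k. diam N (C k)) ` {1..m})"
    using m by (intro Max_ge) auto
  finally show ?thesis
    using diam_nonneg[OF N A] by (simp add: cover_ratio_def)
qed

lemma beta_set_le_cover_ratio:
  assumes N: "is_norm N" and A: "bounded A" and m: "1 \<le> m" and C: "A = (\<Union>k\<in>{1..m}. C k)"
  shows "beta_set N A m \<le> cover_ratio N A m C"
  unfolding beta_set_eq_Inf_cover_ratio
proof (rule cInf_lower)
  show "bdd_below {cover_ratio N A m C | C. A = (\<Union>k\<in>{1..m}. C k)}"
    using cover_ratio_nonneg[OF N A m] by (auto intro!: bdd_belowI[where m = 0])
qed (use C in blast)

lemma beta_set_greatest:
  assumes m: "1 \<le> m" and "\<And>C. A = (\<Union>k\<in>{1..m}. C k) \<Longrightarrow> r \<le> cover_ratio N A m C"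
  shows "r \<le> beta_set N A m"
  unfolding beta_set_eq_Inf_cover_ratio
proof (rule cInf_greatest)
  have "A = (\<Union>k\<in>{1..m}. (\<lambda>_. A) k)"
    using m by auto
  then show "{cover_ratio N A m C | C. A = (\<Union>k\<in>{1..m}. C k)} \<noteq> {}"
    by blast
qed (use assms in blast)

text \<open>The trivial cover, all of whose pieces are \<open>A\<close>, has ratio \<open>1\<close>.\<close>

lemma beta_set_le_1:
  assumes N: "is_norm N" and A: "A \<in> bounded_sets_pos_diam" and m: "1 \<le> m"
  shows "beta_set N A m \<le> 1"
proof -
  have "(\<lambda>k. diam N A) ` {1..m} = {diam N A}"
    using m by auto
  then have "cover_ratio N A m (\<lambda>_. A) = 1"
    using diam_pos[OF N A] by (simp add: cover_ratio_def)
  moreover have "beta_set N A m \<le> cover_ratio N A m (\<lambda>_. A)"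
    using A m by (intro beta_set_le_cover_ratio[OF N]) (auto simp: mem_bounded_sets_pos_diam_iff)
  ultimately show ?thesis by simp
qed

lemma beta_set_le_beta:
  assumes N: "is_norm N" and A: "A \<in> bounded_sets_pos_diam" and m: "1 \<le> m"
  shows "beta_set N A m \<le> beta N m"
  unfolding beta_def using beta_set_le_1[OF N _ m] A
  by (intro cSup_upper) (auto intro!: bdd_aboveI[where M = 1])

lemma bounded_sets_pos_diam_nonempty: "(bounded_sets_pos_diam :: (real ^ 'n) set set) \<noteq> {}"
proof -
  have "{0, 1} \<in> (bounded_sets_pos_diam :: (real ^ 'n) set set)"
    by (auto simp: mem_bounded_sets_pos_diam_iff)
  then show ?thesis by blast
qed

lemma beta_nonneg:
  fixes N :: "real ^ 'n \<Rightarrow> real"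
  assumes N: "is_norm N" and m: "1 \<le> m"
  shows "0 \<le> beta N m"
proof -
  obtain A :: "(real ^ 'n) set" where A: "A \<in> bounded_sets_pos_diam"
    using bounded_sets_pos_diam_nonempty by blast
  then have "0 \<le> beta_set N A m"
    by (intro beta_set_greatest[OF m] cover_ratio_nonneg[OF N _ m])
      (auto simp: mem_bounded_sets_pos_diam_iff)
  then show ?thesis
    using beta_set_le_beta[OF N A m] by linarith
qed

section \<open>Transport along a linear isomorphism\<close>

lemma linear_iso_image_bounded_sets_pos_diam:
  fixes T :: "real ^ 'n \<Rightarrow> real ^ 'k"
  assumes T: "linear T" "inj T" and A: "A \<in> bounded_sets_pos_diam"
  shows "T ` A \<in> bounded_sets_pos_diam"
  using A bounded_linear_image[of A T] T inj_eq[OF T(2)]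
  by (fastforce simp: mem_bounded_sets_pos_diam_iff linear_conv_bounded_linear)

text \<open>
  Here both distortions meet: a cover \<open>C\<close> of \<open>T ` A\<close> pulls back to the cover \<open>inv T ` C k\<close> of \<open>A\<close>,
  the numerator of its ratio grows by at most the norm of \<open>inv T\<close>, and the denominator shrinks by
  at most the norm of \<open>T\<close>.
\<close>

lemma beta_set_le_linear_iso:
  fixes NX NY :: "real ^ 'n \<Rightarrow> real"
  assumes NX: "is_norm NX" and NY: "is_norm NY" and T: "linear T" "bij T"
    and A: "A \<in> bounded_sets_pos_diam" and m: "1 \<le> m"
  shows "beta_set NX A m \<le> op_norm NX NY T * op_norm NY NX (inv T) * beta_set NY (T ` A) m"
proof -
  let ?t = "op_norm NX NY T" and ?s = "op_norm NY NX (inv T)"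
  have S: "linear (inv T)"
    using T by (simp add: inj_linear_imp_inv_linear bij_is_inj)
  have TS: "T (inv T y) = y" and ST: "inv T (T x) = x" for x y
    using T(2) by (simp_all add: bij_is_surj surj_f_inv_f bij_is_inj)
  have nz: "T 1 \<noteq> 0" "inv T 1 \<noteq> 0"
    using ST[of 1] TS[of 1] linear_0[OF S] linear_0[OF T(1)] zero_neq_one[where 'a = "real ^ 'n"]
    by metis+
  have t: "0 < ?t"
    by (rule op_norm_pos[OF NX NY T(1) nz(1)])
  have s: "0 < ?s"
    by (rule op_norm_pos[OF NY NX S nz(2)])
  have TA: "T ` A \<in> bounded_sets_pos_diam"
    using T A by (intro linear_iso_image_bounded_sets_pos_diam) (auto simp: bij_is_inj)
  have bA: "bounded A" and bTA: "bounded (T ` A)"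
    using A TA by (simp_all add: mem_bounded_sets_pos_diam_iff)
  have dA: "0 < diam NX A" and dTA: "0 < diam NY (T ` A)"
    using diam_pos[OF NX A] diam_pos[OF NY TA] by simp_all
  have "beta_set NX A m / (?t * ?s) \<le> beta_set NY (T ` A) m"
  proof (rule beta_set_greatest[OF m])
    fix C assume C: "T ` A = (\<Union>k\<in>{1..m}. C k)"
    let ?M = "Max ((\<lambda>k. diam NY (C k)) ` {1..m})"
    have "A = inv T ` T ` A"
      by (simp add: image_comp o_def ST)
    also have "\<dots> = (\<Union>k\<in>{1..m}. inv T ` C k)"
      unfolding C by blast
    finally have cover: "A = (\<Union>k\<in>{1..m}. inv T ` C k)" .
    have "diam NX (inv T ` C k) \<le> ?s * ?M" if k: "k \<in> {1..m}" for k
    proof -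
      have "diam NX (inv T ` C k) \<le> ?s * diam NY (C k)"
        by (rule diam_linear_image_le[OF NY NX S bounded_cover_piece[OF bTA C k]])
      also have "\<dots> \<le> ?s * ?M"
        using s k by (intro mult_left_mono Max_ge) auto
      finally show ?thesis .
    qed
    then have num: "Max ((\<lambda>k. diam NX (inv T ` C k)) ` {1..m}) \<le> ?s * ?M"
      using m by (subst Max_le_iff) auto
    have M: "0 \<le> ?M"
      using cover_ratio_nonneg[OF NY bTA m C] dTA by (simp add: cover_ratio_def zero_le_divide_iff)
    have den: "1 / diam NX A \<le> ?t / diam NY (T ` A)"
      using diam_linear_image_le[OF NX NY T(1) bA] dA dTA by (simp add: field_simps)
    have "beta_set NX A m \<le> cover_ratio NX A m (\<lambda>k. inv T ` C k)"
      by (rule beta_set_le_cover_ratio[OF NX bA m cover])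
    also have "\<dots> \<le> 1 / diam NX A * (?s * ?M)"
      unfolding cover_ratio_def using num dA by (intro mult_left_mono) auto
    also have "\<dots> \<le> ?t / diam NY (T ` A) * (?s * ?M)"
      using den s M by (intro mult_right_mono) auto
    also have "\<dots> = ?t * ?s * cover_ratio NY (T ` A) m C"
      by (simp add: cover_ratio_def)
    finally show "beta_set NX A m / (?t * ?s) \<le> cover_ratio NY (T ` A) m C"
      using t s by (simp add: field_simps)
  qed
  then show ?thesis
    using t s by (simp add: field_simps)
qed

lemma beta_le_linear_iso:
  fixes NX NY :: "real ^ 'n \<Rightarrow> real"
  assumes NX: "is_norm NX" and NY: "is_norm NY" and T: "linear T" "bij T" and m: "1 \<le> m"
    and p: "op_norm NX NY T * op_norm NY NX (inv T) \<le> p"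
  shows "beta NX m \<le> p * beta NY m"
  unfolding beta_def[of NX]
proof (rule cSup_least)
  show "{beta_set NX A m | A. A \<in> bounded_sets_pos_diam} \<noteq> {}"
    using bounded_sets_pos_diam_nonempty by blast
  let ?q = "op_norm NX NY T * op_norm NY NX (inv T)"
  fix b assume "b \<in> {beta_set NX A m | A. A \<in> bounded_sets_pos_diam}"
  then obtain A where A: "A \<in> bounded_sets_pos_diam" and b: "b = beta_set NX A m"
    by blast
  have TA: "T ` A \<in> bounded_sets_pos_diam"
    using T A by (intro linear_iso_image_bounded_sets_pos_diam) (auto simp: bij_is_inj)
  have S: "linear (inv T)"
    using T by (simp add: inj_linear_imp_inv_linear bij_is_inj)
  have q: "0 \<le> ?q"
    by (intro mult_nonneg_nonneg op_norm_nonneg NX NY T(1) S)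
  have "b \<le> ?q * beta_set NY (T ` A) m"
    unfolding b by (rule beta_set_le_linear_iso[OF NX NY T A m])
  also have "\<dots> \<le> ?q * beta NY m"
    using q by (intro mult_left_mono beta_set_le_beta[OF NY TA m])
  also have "\<dots> \<le> p * beta NY m"
    using p beta_nonneg[OF NY m] by (intro mult_right_mono)
  finally show "b \<le> p * beta NY m" .
qed

theorem theorem2:
  fixes NX NY :: "real ^ 'n \<Rightarrow> real" and \<gamma> :: real
  assumes "is_norm NX" and "is_norm NY"
    and "\<gamma> \<ge> 1"
    and "banach_mazur_dist NX NY \<le> \<gamma>"
  shows "\<forall>m::nat. m \<ge> 1 \<longrightarrow> beta NX m \<le> \<gamma> * beta NY m"
proof (intro allI impI)
  fix m :: nat assume m: "1 \<le> m"
  let ?b = "beta NY m"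
  have b: "0 \<le> ?b"
    by (rule beta_nonneg[OF assms(2) m])
  show "beta NX m \<le> \<gamma> * ?b"
  proof (rule field_le_epsilon)
    fix e :: real assume e: "0 < e"
    \<comment> \<open>The infimum need not be attained a priori, so \<open>T\<close> only comes within \<open>\<epsilon>\<close> of it; this \<open>\<epsilon>\<close> is
      chosen so that \<open>\<epsilon> * ?b \<le> e\<close>, also when \<open>?b = 0\<close>.\<close>
    define \<epsilon> where "\<epsilon> = e / (?b + 1)"
    have \<epsilon>: "0 < \<epsilon>" "\<epsilon> * ?b \<le> e"
      using e b by (simp_all add: \<epsilon>_def field_simps)
    let ?P = "{op_norm NX NY T * op_norm NY NX (inv T) | T :: real ^ 'n \<Rightarrow> real ^ 'n.
                linear T \<and> bij T}"
    have "?P \<noteq> {}"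
      using linear_id bij_id by blast
    moreover have "Inf ?P < \<gamma> + \<epsilon>"
      using assms(4) \<epsilon>(1) by (simp add: banach_mazur_dist_def)
    ultimately obtain T :: "real ^ 'n \<Rightarrow> real ^ 'n" where T: "linear T" "bij T"
        "op_norm NX NY T * op_norm NY NX (inv T) < \<gamma> + \<epsilon>"
      using cInf_lessD[of ?P "\<gamma> + \<epsilon>"] by blast
    have "beta NX m \<le> (\<gamma> + \<epsilon>) * ?b"
      using T by (intro beta_le_linear_iso[OF assms(1,2) T(1,2) m]) simp
    also have "\<dots> \<le> \<gamma> * ?b + e"
      using \<epsilon>(2) by (simp add: algebra_simps)
    finally show "beta NX m \<le> \<gamma> * ?b + e" .
  qed
qed

end
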